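(* Let $T$ be a nonzero $3\times 3$ complex matrix. Then the following conditions are equivalent: (a) $W(T)\subseteq S(\pi/2)$ and $\|T\|/w(T)=\sqrt{2}$; (b) $T/\|T\|$ is unitarily similar to a $3\times 3$ matrix of the form $$\begin{pmatrix} \frac{2}{3} & \frac{1}{\sqrt{3}} & d \\ -\frac{1}{\sqrt{3}} & 0 & \sqrt{3}\,d \\ d & -\sqrt{3}\,d & b_1+ib_2 \end{pmatrix}$$ with real numbers $d,b_1,b_2$ satisfying $$d\ge 0, \qquad b_1\ge \frac{3d^2}{2}, \qquad 18d^2+\sqrt{2(12d^2+b_1)^2+2b_2^2}\le 1.$$ Moreover, if condition (b) holds with $d>0$, then $T$ is unitarily irreducible.
   Context: $\|\cdot\|$ is the operator (spectral) norm. For a complex $n\times n$ matrix $T$, $W(T)=\{\langle Tx,x\rangle : x\in\mathbb{C}^n, \|x\|=1\}$ is the numerical range and $w(T)=\sup\{|\mu|:\mu\in W(T)\}$ is the numerical radius. $S(\pi/2)$ is the closed right half-plane $\{a+ib: a,b\in\mathbb{R},\ a\ge 0\}$, so that $W(T)\subseteq S(\pi/2)$ means that $T+T^*$ is positive semidefinite. A matrix is unitarily irreducible if it is not unitarily similar to a direct sum of two square matrices of smaller (positive) sizes. *)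

theory Defs
  imports "HOL-Analysis.Analysis"
begin

text \<open>The inner product of the library on \<^typ>\<open>complex ^ 'n\<close> is the real one; the norm it induces
  agrees with that of the complex inner product below, which is linear in the first argument.\<close>

definition cinner :: "complex ^ 'n \<Rightarrow> complex ^ 'n \<Rightarrow> complex" where
  "cinner x y = (\<Sum>i\<in>UNIV. x $ i * cnj (y $ i))"

definition conj_transpose :: "complex ^ 'n ^ 'm \<Rightarrow> complex ^ 'm ^ 'n" where
  "conj_transpose A = (\<chi> i j. cnj (A $ j $ i))"

definition op_norm :: "complex ^ 'n ^ 'm \<Rightarrow> real" where
  "op_norm A = onorm ((*v) A)"

definition numerical_range :: "complex ^ 'n ^ 'n \<Rightarrow> complex set" where
  "numerical_range T = {cinner (T *v x) x | x. norm x = 1}"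

definition numerical_radius :: "complex ^ 'n ^ 'n \<Rightarrow> real" where
  "numerical_radius T = Sup {cmod \<mu> | \<mu>. \<mu> \<in> numerical_range T}"

definition right_half_plane :: "complex set" where
  "right_half_plane = {Complex a b | a b. a \<ge> 0}"

text \<open>The index types of rows and columns may differ, so that a matrix indexed by \<^typ>\<open>3\<close> can be
  compared with a direct sum, which is indexed by a sum type. Both equations together force the
  two index types to have the same cardinality.\<close>

definition unitary_matrix :: "complex ^ 'n ^ 'm \<Rightarrow> bool" where
  "unitary_matrix U \<longleftrightarrow> conj_transpose U ** U = mat 1 \<and> U ** conj_transpose U = mat 1"

definition unitarily_similar :: "complex ^ 'n ^ 'n \<Rightarrow> complex ^ 'm ^ 'm \<Rightarrow> bool" where
  "unitarily_similar A B \<longleftrightarrow>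
     (\<exists>U :: complex ^ 'm ^ 'n. unitary_matrix U \<and> A = U ** B ** conj_transpose U)"

definition direct_sum ::
    "complex ^ 'a ^ 'a \<Rightarrow> complex ^ 'b ^ 'b \<Rightarrow> complex ^ ('a + 'b) ^ ('a + 'b)" where
  "direct_sum A B = (\<chi> i j. case (i, j) of
       (Inl k, Inl l) \<Rightarrow> A $ k $ l
     | (Inr k, Inr l) \<Rightarrow> B $ k $ l
     | _ \<Rightarrow> 0)"

text \<open>Sizes are types and cannot be quantified over, so the possible pairs of positive sizes
  with sum 3 are listed.\<close>

definition unitarily_irreducible :: "complex ^ 3 ^ 3 \<Rightarrow> bool" where
  "unitarily_irreducible T \<longleftrightarrow>
     \<not> ((\<exists>(A :: complex ^ 1 ^ 1) (B :: complex ^ 2 ^ 2). unitarily_similar T (direct_sum A B)) \<or>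
        (\<exists>(A :: complex ^ 2 ^ 2) (B :: complex ^ 1 ^ 1). unitarily_similar T (direct_sum A B)))"

definition canonical_matrix :: "real \<Rightarrow> real \<Rightarrow> real \<Rightarrow> complex ^ 3 ^ 3" where
  "canonical_matrix d b1 b2 = vector
     [vector [2 / 3, of_real (1 / sqrt 3), of_real d],
      vector [of_real (- 1 / sqrt 3), 0, of_real (sqrt 3 * d)],
      vector [of_real d, of_real (- sqrt 3 * d), of_real b1 + \<i> * of_real b2]]"

definition admissible :: "real \<Rightarrow> real \<Rightarrow> real \<Rightarrow> bool" where
  "admissible d b1 b2 \<longleftrightarrow>
     d \<ge> 0 \<and> b1 \<ge> 3 * d\<^sup>2 / 2 \<and> 18 * d\<^sup>2 + sqrt (2 * (12 * d\<^sup>2 + b1)\<^sup>2 + 2 * b2\<^sup>2) \<le> 1"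

end

theory Submission
  imports Defs
begin

text \<open>Let \<open>S = T / \<parallel>T\<parallel>\<close>. Condition (a) says that the form \<open>\<langle>S z, z\<rangle>\<close> has nonnegative real part and that the
  numerical radius of \<open>S\<close> is \<open>1 / sqrt 2\<close>, so that \<open>1 - c S\<close> has a form with nonnegative real part whenever
  \<open>\<bar>c\<bar> = sqrt 2\<close>. For all \<open>x\<close> and \<open>y\<close>, twice the gap \<open>\<parallel>x\<parallel>\<^sup>2 + \<parallel>y\<parallel>\<^sup>2 - 2 Re \<langle>S x, y\<rangle>\<close> is the sum of the real
  parts of three such nonnegative forms: those of \<open>2 S\<close> at \<open>x - y\<close>, of \<open>1 - (1 - \<i>) S\<close> at \<open>y + \<i> x\<close> and of
  \<open>1 - (1 + \<i>) S\<close> at \<open>y - \<i> x\<close>. These assumptions alone therefore bound the norm of \<open>S\<close> by 1, and the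
  assumption \<open>\<parallel>S\<parallel> = 1\<close> is the equality case: at a unit vector \<open>x\<close> with \<open>\<parallel>S x\<parallel> = 1\<close> and \<open>y = S x\<close> all
  three forms vanish, and a semidefinite form vanishes only on its kernel
  (\<open>psd_form_zero\<close>). The kernel equations, together with the fact that the numerical range touches
  the circle of radius \<open>1 / sqrt 2\<close> only tangentially, give \<open>\<langle>x, y\<rangle> = 1 / 2\<close> and determine, up to the vector \<open>S\<^sup>* x\<close>, how \<open>S\<close> and its
  adjoint act on \<open>x\<close> and \<open>y\<close> (\<open>norming_pair\<close>). In the orthonormal basis made of \<open>(x + y) / sqrt 3\<close>, \<open>x - y\<close> and a third
  vector of suitable phase, \<open>S\<close> has the canonical form
  (\<open>unitarily_similar_canonical\<close>).

  It remains to see which canonical matrices satisfy the two conditions on the form. Completing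
  squares shows that nonnegativity of the real part is the inequality \<open>b1 \<ge> 3 d\<^sup>2 / 2\<close>
  (\<open>canonical_Re_nonneg_iff\<close>), and that the bound \<open>1 / sqrt 2\<close> on the numerical radius is the other
  inequality of \<open>admissible\<close> (\<open>canonical_numerical_bound_iff\<close>). The radius is always
  at least \<open>1 / sqrt 2\<close> (\<open>canonical_numerical_radius_attained\<close>). As the numerical range is a
  unitary invariant, this gives both implications.

  A unitarily reducible \<open>3 \<times> 3\<close> matrix has an eigenvector that is also one of its adjoint. For \<open>d > 0\<close> the
  eigenvector equations of the canonical matrix and its adjoint have a common solution only for
  parameters that violate the second inequality (\<open>canonical_no_reducing_eigenvector\<close>).\<close>

section \<open>Inner product, adjoint and unitary similarity\<close>

lemma cinner_add_left: "cinner (x + y) z = cinner x z + cinner y z"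
  and cinner_add_right: "cinner z (x + y) = cinner z x + cinner z y"
  and cinner_diff_left: "cinner (x - y) z = cinner x z - cinner y z"
  and cinner_diff_right: "cinner z (x - y) = cinner z x - cinner z y"
  and cinner_smult_left: "cinner (c *s x) z = c * cinner x z"
  and cinner_smult_right: "cinner z (c *s x) = cnj c * cinner z x"
  by (simp_all add: cinner_def algebra_simps sum.distrib sum_subtractf sum_distrib_left)

lemma cinner_commute: "cinner y x = cnj (cinner x y)"
  by (simp add: cinner_def mult.commute)

lemmas cinner_simps = cinner_add_left cinner_add_right cinner_diff_left cinner_diff_right
  cinner_smult_left cinner_smult_right

lemma cinner_self: "cinner x x = of_real ((norm x)\<^sup>2)"
  by (simp add: cinner_def norm_vec_def L2_set_def sum_nonneg flip: complex_norm_square)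

lemma Re_cinner: "Re (cinner x y) = inner x y"
  by (simp add: cinner_def inner_vec_def inner_complex_def)

lemma cinner_zero [simp]: "cinner 0 x = 0" "cinner x 0 = 0"
  by (simp_all add: cinner_def)

lemma norm_cinner_le: "cmod (cinner x y) \<le> norm x * norm y"
proof -
  have "cmod (cinner x y) \<le> (\<Sum>i\<in>UNIV. \<bar>norm (x $ i)\<bar> * \<bar>norm (y $ i)\<bar>)"
    unfolding cinner_def by (rule order_trans[OF norm_sum]) (simp add: norm_mult)
  also have "\<dots> \<le> norm x * norm y"
    unfolding norm_vec_def by (rule L2_set_mult_ineq)
  finally show ?thesis .
qed

lemma cinner_matrix_vector: "cinner (A *v x) y = cinner x (conj_transpose A *v y)"
proof -
  have "cinner (A *v x) y = (\<Sum>i\<in>UNIV. \<Sum>j\<in>UNIV. A $ i $ j * x $ j * cnj (y $ i))"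
    by (simp add: cinner_def matrix_vector_mult_def sum_distrib_right)
  also have "\<dots> = (\<Sum>j\<in>UNIV. \<Sum>i\<in>UNIV. A $ i $ j * x $ j * cnj (y $ i))"
    by (rule sum.swap)
  also have "\<dots> = cinner x (conj_transpose A *v y)"
    by (simp add: cinner_def conj_transpose_def matrix_vector_mult_def sum_distrib_left mult_ac)
  finally show ?thesis .
qed

lemma conj_transpose_conj_transpose [simp]: "conj_transpose (conj_transpose A) = A"
  by (simp add: conj_transpose_def vec_eq_iff)

lemma conj_transpose_mult: "conj_transpose (A ** B) = conj_transpose B ** conj_transpose A"
  by (simp add: conj_transpose_def matrix_matrix_mult_def vec_eq_iff mult.commute)

lemma conj_transpose_scaleR: "conj_transpose (r *\<^sub>R A) = r *\<^sub>R conj_transpose A"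
  by (simp add: conj_transpose_def vec_eq_iff)

lemma scaleR_matrix_vector: "(r *\<^sub>R A) *v x = r *\<^sub>R (A *v x)" for A :: "complex ^ 'n ^ 'm"
  by (simp add: matrix_vector_mult_def vec_eq_iff scaleR_sum_right)

lemma matrix_vector_scaleR: "A *v (r *\<^sub>R x) = r *\<^sub>R (A *v x)" for A :: "complex ^ 'n ^ 'm"
  by (simp add: matrix_vector_mult_def vec_eq_iff scaleR_sum_right)

lemma scaleR_eq_smult: "r *\<^sub>R x = complex_of_real r *s x"
  by (simp add: vec_eq_iff) (simp add: scaleR_conv_of_real)

lemma cinner_scaleR: "cinner (r *\<^sub>R x) y = of_real r * cinner x y"
  "cinner x (r *\<^sub>R y) = of_real r * cinner x y"
  by (simp_all add: scaleR_eq_smult cinner_simps)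

lemma unitary_norm:
  assumes "unitary_matrix U" shows "norm (U *v x) = norm x"
proof -
  have "cinner (U *v x) (U *v x) = cinner x x"
    using assms by (simp add: cinner_matrix_vector matrix_vector_mul_assoc unitary_matrix_def)
  then show ?thesis by (simp add: cinner_self flip: of_real_power)
qed

lemma unitary_conj_transpose: "unitary_matrix U \<Longrightarrow> unitary_matrix (conj_transpose U)"
  by (simp add: unitary_matrix_def)

lemma cinner_unitary_congruence:
  "cinner ((U ** B ** conj_transpose U) *v x) x =
    cinner (B *v (conj_transpose U *v x)) (conj_transpose U *v x)"
  by (simp add: cinner_matrix_vector[of U] flip: matrix_vector_mul_assoc)

lemma scalar_mat_vector: "mat c *v z = c *s z" for z :: "complex ^ 'n"
  by (simp add: vec_eq_iff matrix_vector_mult_def mat_def if_distrib[where f = "\<lambda>a. a * _"] cong: if_cong)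

lemma conj_transpose_diff: "conj_transpose (A - B) = conj_transpose A - conj_transpose B"
  by (simp add: conj_transpose_def vec_eq_iff)

lemma conj_transpose_mat: "conj_transpose (mat c) = mat (cnj c)"
  by (simp add: conj_transpose_def mat_def vec_eq_iff)

lemma unitarily_similar_sym:
  assumes "unitarily_similar A B" shows "unitarily_similar B A"
proof -
  obtain U where U: "unitary_matrix U" "A = U ** B ** conj_transpose U"
    using assms by (auto simp: unitarily_similar_def)
  have "conj_transpose U ** A ** U = (conj_transpose U ** U) ** B ** (conj_transpose U ** U)"
    unfolding U(2) by (simp only: matrix_mul_assoc)
  then have "B = conj_transpose U ** A ** conj_transpose (conj_transpose U)"
    using U(1) by (simp add: unitary_matrix_def)
  then show ?thesis
    unfolding unitarily_similar_def using unitary_conj_transpose[OF U(1)] by blast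
qed

section \<open>Numerical range, numerical radius and operator norm\<close>

lemma numerical_range_unitarily_similar:
  assumes "unitarily_similar A B"
  shows "numerical_range A = numerical_range B"
proof -
  obtain U where U: "unitary_matrix U" "A = U ** B ** conj_transpose U"
    using assms by (auto simp: unitarily_similar_def)
  have "cinner (A *v x) x \<in> numerical_range B" if "norm x = 1" for x
    unfolding numerical_range_def U(2) cinner_unitary_congruence
    using that unitary_norm[OF unitary_conj_transpose[OF U(1)]] by auto
  moreover have "cinner (B *v x) x \<in> numerical_range A" if "norm x = 1" for x
  proof -
    have "x = conj_transpose U *v (U *v x)"
      using U(1) by (simp add: matrix_vector_mul_assoc unitary_matrix_def)
    then have "cinner (B *v x) x = cinner (A *v (U *v x)) (U *v x)"
      unfolding U(2) cinner_unitary_congruence by simp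
    then show ?thesis unfolding numerical_range_def
      using that unitary_norm[OF U(1)] by auto
  qed
  ultimately show ?thesis by (auto simp: numerical_range_def)
qed

lemma numerical_range_scaleR: "numerical_range (r *\<^sub>R A) = (*) (of_real r) ` numerical_range A"
  by (auto simp: numerical_range_def scaleR_matrix_vector cinner_scaleR)

lemma in_numerical_range:
  assumes "x \<noteq> 0"
  shows "cinner (A *v x) x / of_real ((norm x)\<^sup>2) \<in> numerical_range A"
proof -
  define y where "y = (1 / norm x) *\<^sub>R x"
  have "norm y = 1" using assms by (simp add: y_def)
  moreover have "cinner (A *v y) y = cinner (A *v x) x / of_real ((norm x)\<^sup>2)"
    by (simp add: y_def matrix_vector_scaleR cinner_scaleR power2_eq_square)
  ultimately show ?thesis unfolding numerical_range_def by (metis (mono_tags, lifting) mem_Collect_eq)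
qed

lemma numerical_range_right_half_plane_iff:
  "numerical_range A \<subseteq> right_half_plane \<longleftrightarrow> (\<forall>x. 0 \<le> Re (cinner (A *v x) x))"
proof -
  have *: "z \<in> right_half_plane \<longleftrightarrow> 0 \<le> Re z" for z
    unfolding right_half_plane_def by (cases z) auto
  have "0 \<le> Re (cinner (A *v x) x)" if "numerical_range A \<subseteq> right_half_plane" for x
  proof (cases "x = 0")
    case False
    then have "0 \<le> Re (cinner (A *v x) x / of_real ((norm x)\<^sup>2))"
      using in_numerical_range[OF False, of A] that * by blast
    then show ?thesis using False by (simp add: Re_divide_of_real zero_le_divide_iff del: of_real_power)
  qed simp
  then show ?thesis using * by (auto simp: numerical_range_def)
qed

lemma bounded_linear_mult_vec: "bounded_linear ((*v) A)" for A :: "complex ^ 'n ^ 'm"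
  by (rule matrix_vector_mul_bounded_linear)

lemma bdd_above_numerical_range: "bdd_above (cmod ` numerical_range A)"
proof (rule bdd_aboveI2)
  fix z assume "z \<in> numerical_range A"
  then obtain x where x: "norm x = 1" "z = cinner (A *v x) x" by (auto simp: numerical_range_def)
  have "cmod z \<le> norm (A *v x) * norm x" unfolding x(2) by (rule norm_cinner_le)
  also have "\<dots> \<le> onorm ((*v) A)" using onorm[OF bounded_linear_mult_vec, of A x] x by simp
  finally show "cmod z \<le> onorm ((*v) A)" .
qed

lemma numerical_radius_eq_SUP: "numerical_radius A = (SUP \<mu>\<in>numerical_range A. cmod \<mu>)"
  by (simp add: numerical_radius_def image_def setcompr_eq_image)

lemma cinner_le_numerical_radius: "cmod (cinner (A *v x) x) \<le> numerical_radius A * (norm x)\<^sup>2"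
proof (cases "x = 0")
  case False
  have "cmod (cinner (A *v x) x / of_real ((norm x)\<^sup>2)) \<le> numerical_radius A"
    unfolding numerical_radius_eq_SUP
    by (rule cSUP_upper[OF in_numerical_range[OF False] bdd_above_numerical_range])
  then show ?thesis using False by (simp add: norm_divide field_simps norm_power)
qed simp

lemma op_norm_pos: "A \<noteq> 0 \<Longrightarrow> op_norm A > 0" for A :: "complex ^ 'n ^ 'm"
  unfolding op_norm_def onorm_pos_lt[OF bounded_linear_mult_vec]
  by (metis matrix_eq matrix_vector_mult_0)

text \<open>By compactness of the unit sphere.\<close>

lemma op_norm_attained:
  fixes A :: "complex ^ 'n ^ 'm"
  obtains x where "norm x = 1" "norm (A *v x) = op_norm A"
proof -
  have "continuous_on (sphere 0 1) (\<lambda>x. norm (A *v x))"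
    by (intro continuous_intros linear_continuous_on bounded_linear_mult_vec)
  then obtain x where x: "x \<in> sphere 0 1"
    and max: "\<And>y. y \<in> sphere 0 1 \<Longrightarrow> norm (A *v y) \<le> norm (A *v x)"
    using continuous_attains_sup[of "sphere 0 (1::real) :: (complex^'n) set"]
    by (metis compact_sphere sphere_eq_empty zero_neq_one not_one_less_zero)
  have "onorm ((*v) A) \<le> norm (A *v x)"
  proof (rule onorm_bound)
    fix y
    show "norm (A *v y) \<le> norm (A *v x) * norm y"
    proof (cases "y = 0")
      case False
      then have "norm (A *v ((1 / norm y) *\<^sub>R y)) \<le> norm (A *v x)" by (intro max) simp
      then show ?thesis using False by (simp add: matrix_vector_scaleR field_simps)
    qed simp
  qed simp
  moreover have "norm (A *v x) \<le> onorm ((*v) A)"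
    using onorm[OF bounded_linear_mult_vec, of A x] x by simp
  ultimately show ?thesis using that[of x] x by (simp add: op_norm_def)
qed

lemma numerical_range_bound_iff:
  "(\<forall>\<mu>\<in>numerical_range A. cmod \<mu> \<le> c) \<longleftrightarrow> (\<forall>z. cmod (cinner (A *v z) z) \<le> c * (norm z)\<^sup>2)"
proof
  assume bound: "\<forall>\<mu>\<in>numerical_range A. cmod \<mu> \<le> c"
  show "\<forall>z. cmod (cinner (A *v z) z) \<le> c * (norm z)\<^sup>2"
  proof
    fix z
    show "cmod (cinner (A *v z) z) \<le> c * (norm z)\<^sup>2"
    proof (cases "z = 0")
      case False
      then show ?thesis
        using bound[rule_format, OF in_numerical_range[OF False]] by (simp add: norm_divide norm_power field_simps)
    qed simp
  qed
next
  assume "\<forall>z. cmod (cinner (A *v z) z) \<le> c * (norm z)\<^sup>2"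
  then show "\<forall>\<mu>\<in>numerical_range A. cmod \<mu> \<le> c"
    unfolding numerical_range_def by auto (metis mult_1_right power_one)
qed

section \<open>The numerical range of the canonical matrix\<close>

lemma canonical_mult_components:
  "(canonical_matrix d b1 b2 *v z) $ 1 = 2 / 3 * z $ 1 + of_real (1 / sqrt 3) * z $ 2 + of_real d * z $ 3"
  "(canonical_matrix d b1 b2 *v z) $ 2 = of_real (sqrt 3 * d) * z $ 3 - of_real (1 / sqrt 3) * z $ 1"
  "(canonical_matrix d b1 b2 *v z) $ 3 =
     of_real d * z $ 1 - of_real (sqrt 3 * d) * z $ 2 + Complex b1 b2 * z $ 3"
  by (simp_all add: canonical_matrix_def matrix_vector_mult_def sum_3 complex_eq_iff)

lemma cinner_3: "cinner x y = x $ 1 * cnj (y $ 1) + x $ 2 * cnj (y $ 2) + x $ 3 * cnj (y $ 3)"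
  for x y :: "complex ^ 3"
  by (simp add: cinner_def sum_3)

lemma norm_3_power2: "(norm x)\<^sup>2 = (cmod (x $ 1))\<^sup>2 + (cmod (x $ 2))\<^sup>2 + (cmod (x $ 3))\<^sup>2"
  for x :: "complex ^ 3"
  by (simp add: norm_vec_def L2_set_def sum_3)

lemma inverse_sqrt_3: "1 / sqrt 3 = sqrt 3 / 3" by (simp add: real_div_sqrt divide_simps)

text \<open>Completing the square in the Hermitian part of the canonical matrix. The second row and
  column of that part vanish, so only two of the three coordinates occur.\<close>

lemma canonical_form_Re:
  "Re (cinner (canonical_matrix d b1 b2 *v z) z) =
    2 / 3 * (cmod (z $ 1 + of_real (3 * d / 2) * z $ 3))\<^sup>2 + (b1 - 3 * d\<^sup>2 / 2) * (cmod (z $ 3))\<^sup>2"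
  unfolding cinner_3 canonical_mult_components cmod_power2 inverse_sqrt_3
  by (simp add: field_simps power2_eq_square)

text \<open>The left-hand side is the form of \<open>1 - p H - q K\<close>, where \<open>H + \<i> K\<close> is the canonical matrix
  and \<open>H\<close>, \<open>K\<close> are Hermitian. Completing the square in \<open>z\<^sub>2\<close> leaves, by
  \<open>q\<^sup>2 = 2 - p\<^sup>2\<close>, the coefficient \<open>(1 - p)\<^sup>2 / 3\<close> of \<open>\<bar>z\<^sub>1\<bar>\<^sup>2\<close> and \<open>d (1 - p) (2 + p)\<close> in the mixed
  term, so that completing the square in \<open>z\<^sub>1\<close> requires no division by \<open>1 - p\<close>; what remains is linear
  in \<open>p\<close> and \<open>q\<close>.\<close>

lemma canonical_form_sum_of_squares:
  assumes pq: "p\<^sup>2 + q\<^sup>2 = 2"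
  shows "(norm z)\<^sup>2 - (p * Re (cinner (canonical_matrix d b1 b2 *v z) z)
                      + q * Im (cinner (canonical_matrix d b1 b2 *v z) z)) =
    (cmod (z $ 2 - \<i> * of_real (q / sqrt 3) * z $ 1 + \<i> * of_real (sqrt 3 * q * d) * z $ 3))\<^sup>2
    + (cmod (of_real (1 - p) * z $ 1 + of_real (3 * d * (2 + p)) * z $ 3))\<^sup>2 / 3
    + (1 - 18 * d\<^sup>2 - (p * (12 * d\<^sup>2 + b1) + q * b2)) * (cmod (z $ 3))\<^sup>2"
proof -
  define r where "r = sqrt 3"
  have r: "r\<^sup>2 = 3" by (simp add: r_def)
  have r': "1 / sqrt 3 = r / 3" "q / sqrt 3 = q * r / 3"
    using inverse_sqrt_3 by (simp_all add: r_def field_simps)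
  have alg: "(x1^2+y1^2+x2^2+y2^2+x3^2+y3^2) - p * (2/3*(x1^2+y1^2) + 2*d*(x1*x3+y1*y3) + b1*(x3^2+y3^2))
     - q * (2*r/3*(y2*x1-x2*y1) + 2*r*d*(y3*x2-x3*y2) + b2*(x3^2+y3^2)) =
     (x2 + q*r/3*y1 - r*q*d*y3)^2 + (y2 - q*r/3*x1 + r*q*d*x3)^2
     + 1/3 * (((1-p)*x1 + 3*d*(2+p)*x3)^2 + ((1-p)*y1+3*d*(2+p)*y3)^2)
     + (1-18*d^2-p*(12*d^2+b1)-q*b2)*(x3^2+y3^2)" (is "?lhs = ?rhs") for x1 x2 x3 y1 y2 y3 :: real
  proof -
    \<comment> \<open>The two sides agree modulo the relations \<open>r\<^sup>2 = 3\<close> and \<open>p\<^sup>2 + q\<^sup>2 = 2\<close>.\<close>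
    define X where "X = (x1\<^sup>2 + y1\<^sup>2) / 9 - 2 / 3 * d * (x1 * x3 + y1 * y3) + d\<^sup>2 * (x3\<^sup>2 + y3\<^sup>2)"
    have "?rhs - ?lhs = (r\<^sup>2 - 3) * q\<^sup>2 * X + (p\<^sup>2 + q\<^sup>2 - 2) * (3 * X)"
      unfolding X_def by (simp add: field_simps power2_eq_square)
    then show ?thesis using r pq by simp
  qed
  have re: "Re (cinner (canonical_matrix d b1 b2 *v z) z) =
      2/3*(Re (z$1)^2+Im (z$1)^2) + 2*d*(Re (z$1)*Re (z$3)+Im (z$1)*Im (z$3)) + b1*(Re (z$3)^2+Im (z$3)^2)"
    unfolding cinner_3 canonical_mult_components
    by (simp add: algebra_simps power2_eq_square)
  have im: "Im (cinner (canonical_matrix d b1 b2 *v z) z) =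
      2*r/3*(Im (z$2)*Re (z$1)-Re (z$2)*Im (z$1)) + 2*r*d*(Im (z$3)*Re (z$2)-Re (z$3)*Im (z$2))
        + b2*(Re (z$3)^2+Im (z$3)^2)"
    unfolding cinner_3 canonical_mult_components r'
    unfolding r_def[symmetric]
    by (simp add: field_simps power2_eq_square)
  show ?thesis
    unfolding re im norm_3_power2 cmod_power2 r'
    unfolding r_def[symmetric]
    using alg[of "Re (z$1)" "Im (z$1)" "Re (z$2)" "Im (z$2)" "Re (z$3)" "Im (z$3)"]
    by (simp add: algebra_simps)
qed

lemma canonical_Re_nonneg_iff:
  "(\<forall>z. 0 \<le> Re (cinner (canonical_matrix d b1 b2 *v z) z)) \<longleftrightarrow> 3 * d\<^sup>2 / 2 \<le> b1"
proof
  assume nonneg: "\<forall>z. 0 \<le> Re (cinner (canonical_matrix d b1 b2 *v z) z)"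
  show "3 * d\<^sup>2 / 2 \<le> b1"
    using nonneg[rule_format, of "vector [- of_real (3 * d / 2), 0, 1]"]
    unfolding canonical_form_Re by simp
next
  assume "3 * d\<^sup>2 / 2 \<le> b1"
  then show "\<forall>z. 0 \<le> Re (cinner (canonical_matrix d b1 b2 *v z) z)"
    unfolding canonical_form_Re by simp
qed

lemma sqrt_2_cmod: "sqrt (2 * (Re w)\<^sup>2 + 2 * (Im w)\<^sup>2) = sqrt 2 * cmod w"
  by (simp only: cmod_def real_sqrt_mult[symmetric] distrib_left)

lemma circle_dot_le:
  fixes u v p q :: real
  assumes "p\<^sup>2 + q\<^sup>2 = 2"
  shows "p * u + q * v \<le> sqrt (2 * u\<^sup>2 + 2 * v\<^sup>2)"
proof (rule real_le_rsqrt)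
  have "(p * u + q * v)\<^sup>2 \<le> (p * u + q * v)\<^sup>2 + (p * v - q * u)\<^sup>2"
    by simp
  also have "\<dots> = (p\<^sup>2 + q\<^sup>2) * (u\<^sup>2 + v\<^sup>2)"
    by algebra
  finally show "(p * u + q * v)\<^sup>2 \<le> 2 * u\<^sup>2 + 2 * v\<^sup>2"
    by (simp add: assms)
qed

lemma circle_cos_sin: "(sqrt 2 * cos t)\<^sup>2 + (sqrt 2 * sin t)\<^sup>2 = 2"
  by (simp add: power_mult_distrib flip: distrib_left)

lemma circle_dot_attained:
  fixes u v :: real
  obtains t where "sqrt 2 * cos t * u + sqrt 2 * sin t * v = sqrt (2 * u\<^sup>2 + 2 * v\<^sup>2)"
proof -
  obtain a t where "u = a * cos t" "v = a * sin t" "a \<ge> 0"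
  proof -
    have "Complex u v = cmod (Complex u v) * cis (Arg (Complex u v))"
      using rcis_cmod_Arg[of "Complex u v"] by (simp add: rcis_def)
    then show ?thesis using that[of "cmod (Complex u v)" "Arg (Complex u v)"]
      by (simp add: complex_eq_iff)
  qed
  moreover have "2 * (a * cos t)\<^sup>2 + 2 * (a * sin t)\<^sup>2 = 2 * a\<^sup>2"
    using sin_cos_squared_add[of t] by algebra
  moreover have "sqrt 2 * cos t * (a * cos t) + sqrt 2 * sin t * (a * sin t) = sqrt 2 * a"
    using sin_cos_squared_add[of t] by algebra
  ultimately show ?thesis using that[of t] by (simp add: real_sqrt_mult)
qed

text \<open>The numerical range lies in the disc of radius \<open>1 / sqrt 2\<close> iff the form in
  \<open>canonical_form_sum_of_squares\<close> is nonnegative for all \<open>(p, q)\<close> on the circle of radius \<open>sqrt 2\<close>.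
  The last coefficient there is smallest when \<open>(p, q)\<close> points in the direction of
  \<open>(12 d\<^sup>2 + b1, b2)\<close>, and its nonnegativity there is the right-hand side. That it must be nonnegative
  is seen by choosing \<open>z\<close> such that both squares vanish. There is such a \<open>z\<close> with \<open>z\<^sub>3 = 1\<close> as long as \<open>p \<noteq> 1\<close>;
  the coefficient at \<open>p = 1\<close> is a limit of those at nearby points of the circle.\<close>

lemma canonical_numerical_bound_iff:
  "(\<forall>z. cmod (cinner (canonical_matrix d b1 b2 *v z) z) \<le> (norm z)\<^sup>2 / sqrt 2) \<longleftrightarrow>
    18 * d\<^sup>2 + sqrt (2 * (12 * d\<^sup>2 + b1)\<^sup>2 + 2 * b2\<^sup>2) \<le> 1"
  (is "(\<forall>z. ?bound z) \<longleftrightarrow> ?R")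
proof
  assume bound: "\<forall>z. ?bound z"
  define g where "g t = 1 - 18 * d\<^sup>2 - (sqrt 2 * cos t * (12 * d\<^sup>2 + b1) + sqrt 2 * sin t * b2)" for t
  have g_nonneg: "0 \<le> g t" if "sqrt 2 * cos t \<noteq> 1" for t
  proof -
    define p where "p = sqrt 2 * cos t"
    define q where "q = sqrt 2 * sin t"
    have pq: "p\<^sup>2 + q\<^sup>2 = 2"
      unfolding p_def q_def by (rule circle_cos_sin)
    \<comment> \<open>The vector at which both squares vanish.\<close>
    define w1 where "w1 = complex_of_real (- 3 * d * (2 + p) / (1 - p))"
    define z :: "complex ^ 3" where "z = vector [w1,
      \<i> * of_real (q / sqrt 3) * w1 - \<i> * of_real (sqrt 3 * q * d), 1]"
    let ?w = "cinner (canonical_matrix d b1 b2 *v z) z"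
    have "p \<noteq> 1" using that by (simp add: p_def)
    then have "of_real (1 - p) * z $ 1 + of_real (3 * d * (2 + p)) * z $ 3 = 0"
      by (simp add: z_def w1_def complex_eq_iff field_simps)
    moreover have "z $ 2 - \<i> * of_real (q / sqrt 3) * z $ 1 + \<i> * of_real (sqrt 3 * q * d) * z $ 3 = 0"
      by (simp add: z_def)
    moreover have "z $ 3 = 1" by (simp add: z_def)
    ultimately have "(norm z)\<^sup>2 - (p * Re ?w + q * Im ?w) = g t"
      unfolding canonical_form_sum_of_squares[OF pq]
      by (simp only: g_def p_def q_def) simp
    moreover have "p * Re ?w + q * Im ?w \<le> (norm z)\<^sup>2"
    proof -
      have "p * Re ?w + q * Im ?w \<le> sqrt (2 * (Re ?w)\<^sup>2 + 2 * (Im ?w)\<^sup>2)"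
        by (rule circle_dot_le[OF pq])
      also have "\<dots> = sqrt 2 * cmod ?w"
        by (rule sqrt_2_cmod)
      also have "\<dots> \<le> (norm z)\<^sup>2"
        using bound[rule_format, of z] by (simp add: field_simps)
      finally show ?thesis .
    qed
    ultimately show ?thesis by simp
  qed
  have all: "0 \<le> g t" for t
  proof (rule ccontr)
    assume "\<not> 0 \<le> g t"
    moreover have "isCont g t" unfolding g_def by (intro continuous_intros)
    ultimately have "\<forall>\<^sub>F s in at t. g s < 0"
      by (intro order_tendstoD(2)) (auto simp: isCont_def)
    \<comment> \<open>The circle meets \<open>p = 1\<close> transversally, so nearby points avoid that line.\<close>
    moreover have "\<forall>\<^sub>F s in at t. sqrt 2 * cos s \<noteq> 1"
    proof (cases "sqrt 2 * cos t = 1")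
      case False
      have "((\<lambda>s. sqrt 2 * cos s) \<longlongrightarrow> sqrt 2 * cos t) (at t)"
        by (intro tendsto_intros)
      then show ?thesis using False by (rule tendsto_imp_eventually_ne)
    next
      case True
      have "sin t \<noteq> 0"
      proof
        assume "sin t = 0"
        then have "(sqrt 2 * cos t)\<^sup>2 = 2"
          using circle_cos_sin[of t] by simp
        then show False using True by simp
      qed
      have "((\<lambda>s. sqrt 2 * cos s) has_field_derivative - sqrt 2 * sin t) (at t)"
        by (auto intro!: derivative_eq_intros)
      then have "((\<lambda>s. (sqrt 2 * cos s - sqrt 2 * cos t) / (s - t)) \<longlongrightarrow> - sqrt 2 * sin t) (at t)"
        by (simp add: has_field_derivative_iff)
      then have "\<forall>\<^sub>F s in at t. (sqrt 2 * cos s - sqrt 2 * cos t) / (s - t) \<noteq> 0"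
        by (rule tendsto_imp_eventually_ne) (use \<open>sin t \<noteq> 0\<close> in simp)
      then show ?thesis using True by (auto elim!: eventually_mono)
    qed
    ultimately have "\<forall>\<^sub>F s in at t. False"
      by eventually_elim (use g_nonneg in force)
    then show False by simp
  qed
  obtain t where t: "sqrt 2 * cos t * (12 * d\<^sup>2 + b1) + sqrt 2 * sin t * b2 =
      sqrt (2 * (12 * d\<^sup>2 + b1)\<^sup>2 + 2 * b2\<^sup>2)"
    by (rule circle_dot_attained)
  show ?R using all[of t] unfolding g_def t by simp
next
  assume R: ?R
  show "\<forall>z. ?bound z"
  proof
    fix z
    let ?w = "cinner (canonical_matrix d b1 b2 *v z) z"
    obtain t where t: "sqrt 2 * cos t * Re ?w + sqrt 2 * sin t * Im ?w = sqrt (2 * (Re ?w)\<^sup>2 + 2 * (Im ?w)\<^sup>2)"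
      by (rule circle_dot_attained)
    define p where "p = sqrt 2 * cos t"
    define q where "q = sqrt 2 * sin t"
    have pq: "p\<^sup>2 + q\<^sup>2 = 2"
      unfolding p_def q_def by (rule circle_cos_sin)
    have "0 \<le> 1 - 18 * d\<^sup>2 - (p * (12 * d\<^sup>2 + b1) + q * b2)"
      using circle_dot_le[OF pq, of "12 * d\<^sup>2 + b1" b2] R by linarith
    then have "0 \<le> (norm z)\<^sup>2 - (p * Re ?w + q * Im ?w)"
      unfolding canonical_form_sum_of_squares[OF pq] by (intro add_nonneg_nonneg mult_nonneg_nonneg) auto
    moreover have "p * Re ?w + q * Im ?w = sqrt 2 * cmod ?w"
      unfolding p_def q_def t by (rule sqrt_2_cmod)
    ultimately show "?bound z" by (simp add: field_simps)
  qed
qed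

text \<open>The witness is, up to a scalar, the vector \<open>y + \<i> x\<close> of \<open>norming_pair\<close> in the basis of the
  canonical form; the value there is \<open>(1 + \<i>) / 2\<close>.\<close>

lemma canonical_numerical_radius_attained:
  "\<exists>\<mu>\<in>numerical_range (canonical_matrix d b1 b2). cmod \<mu> = 1 / sqrt 2"
proof -
  define z :: "complex ^ 3" where "z = vector [of_real (sqrt 3 / 2), \<i> / 2, 0]"
  have "(norm z)\<^sup>2 = 1" by (simp add: norm_3_power2 z_def power_divide norm_divide)
  then have "norm z = 1" using power2_eq_imp_eq[of "norm z" 1] by simp
  moreover have "cinner (canonical_matrix d b1 b2 *v z) z = Complex (1 / 2) (1 / 2)"
    unfolding cinner_3 canonical_mult_components by (simp add: z_def complex_eq_iff)
  moreover have "cmod (Complex (1 / 2) (1 / 2)) = 1 / sqrt 2"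
    by (simp add: cmod_def power_divide real_sqrt_divide)
  ultimately show ?thesis unfolding numerical_range_def by force
qed

section \<open>Matrices that attain the extremal ratio\<close>

text \<open>A Hermitian positive semidefinite form vanishes only on its kernel: moving from \<open>u\<close> a small step
  \<open>t\<close> against \<open>w = A u + A\<^sup>* u\<close> changes the form by \<open>- t \<parallel>w\<parallel>\<^sup>2\<close> to first order, which positivity
  forbids unless \<open>w = 0\<close>. The real part of the form of \<open>A\<close> is the form of its Hermitian part, hence
  the sum with the adjoint.\<close>

lemma psd_form_zero:
  assumes psd: "\<And>z. 0 \<le> Re (cinner (A *v z) z)" and zero: "Re (cinner (A *v u) u) = 0"
  shows "A *v u + conj_transpose A *v u = 0"
proof -
  define w where "w = A *v u + conj_transpose A *v u"
  define c where "c = Re (cinner (A *v w) w)"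
  have "0 \<le> t * (t * c - (norm w)\<^sup>2)" for t
  proof -
    have uw: "cinner (A *v u) w + cinner (A *v w) u = cinner (A *v u) w + cnj (cinner (conj_transpose A *v u) w)"
      by (simp add: cinner_matrix_vector[of A w u] cinner_commute[of w])
    have "Re (cinner (A *v (u - t *\<^sub>R w)) (u - t *\<^sub>R w)) =
        t * t * c - t * Re (cinner (A *v u) w + cinner (A *v w) u)"
      unfolding matrix_vector_mult_diff_distrib matrix_vector_scaleR cinner_diff_left cinner_diff_right cinner_scaleR
      using zero by (simp add: c_def algebra_simps)
    also have "Re (cinner (A *v u) w + cinner (A *v w) u) = Re (cinner w w)"
      unfolding uw by (simp add: w_def cinner_add_left)
    also have "\<dots> = (norm w)\<^sup>2" by (simp add: cinner_self)
    finally show ?thesis using psd[of "u - t *\<^sub>R w"] by (simp add: algebra_simps)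
  qed
  note quad = this
  have "norm w = 0"
  proof (rule ccontr)
    assume "norm w \<noteq> 0"
    then have n: "0 < (norm w)\<^sup>2" by simp
    have "0 \<le> c" unfolding c_def by (rule psd)
    define t where "t = (norm w)\<^sup>2 / (c + 1)"
    have "0 < t" using n \<open>0 \<le> c\<close> by (simp add: t_def)
    have "t * c < t * (c + 1)" using \<open>0 < t\<close> by simp
    also have "\<dots> = (norm w)\<^sup>2" using \<open>0 \<le> c\<close> by (simp add: t_def)
    finally show False using quad[of t] \<open>0 < t\<close> by (simp add: zero_le_mult_iff)
  qed
  then show ?thesis by (simp add: w_def)
qed

text \<open>The line \<open>Re c + Im c = n\<close> touches the disc of radius \<open>n / sqrt 2\<close> in a single point. Here \<open>c\<close> is
  a value of the form of a matrix on a vector with \<open>n = \<parallel>v\<parallel>\<^sup>2\<close>.\<close>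

lemma tangent_point_of_disc:
  fixes c :: complex
  assumes "Re c + Im c = n" "cmod c \<le> n / sqrt 2"
  shows "Re c = n / 2" "Im c = n / 2"
proof -
  have "(cmod c)\<^sup>2 \<le> (n / sqrt 2)\<^sup>2" using assms(2) by (intro power_mono) auto
  then have "(Re c)\<^sup>2 + (Im c)\<^sup>2 \<le> n\<^sup>2 / 2" by (simp add: cmod_power2 power_divide)
  moreover have "(Re c)\<^sup>2 + (Im c)\<^sup>2 = (Re c + Im c)\<^sup>2 / 2 + (Re c - Im c)\<^sup>2 / 2"
    by (simp add: power2_eq_square field_simps)
  ultimately have "(Re c - Im c)\<^sup>2 \<le> 0" using assms(1) by simp
  then show "Re c = n / 2" "Im c = n / 2" using assms(1) by simp_all
qed

text \<open>The equality case of \<open>\<parallel>S\<parallel> \<le> 1\<close>. Both \<open>A = 1 - (1 - \<i>) S\<close> and \<open>B = 1 - (1 + \<i>) S\<close> have a form with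
  nonnegative real part, because \<open>1 \<mp> \<i>\<close> has modulus \<open>sqrt 2\<close>. For all \<open>x\<close> and \<open>y\<close>, the number
  \<open>2 (\<parallel>x\<parallel>\<^sup>2 + \<parallel>y\<parallel>\<^sup>2 - 2 Re \<langle>S x, y\<rangle>)\<close> is the sum of twice the form of \<open>S\<close> at \<open>x - y\<close>, the form of \<open>A\<close>
  at \<open>y + \<i> x\<close> and the form of \<open>B\<close> at \<open>y - \<i> x\<close> (real parts). It is zero for a unit vector \<open>x\<close>
  with \<open>y = S x\<close> of norm 1, so each of the three forms vanishes, and the three resulting kernel
  equations determine how \<open>S\<close> and its adjoint act on \<open>x\<close> and \<open>y\<close>, up to \<open>S\<^sup>* x\<close>.
  That the forms of \<open>A\<close> and \<open>B\<close> vanish also means that the form of \<open>S\<close> takes values where a line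
  touches the disc containing the numerical range; the two tangencies give the two real equations
  \<open>2 Re \<langle>x, y\<rangle> = 1 \<mp> Im \<langle>x, y\<rangle>\<close>.\<close>

lemma norming_pair:
  fixes S :: "complex ^ 'n ^ 'n"
  assumes pos: "\<And>z. 0 \<le> Re (cinner (S *v z) z)"
    and rad: "\<And>z. cmod (cinner (S *v z) z) \<le> (norm z)\<^sup>2 / sqrt 2"
    and x: "norm x = 1" and y: "norm (S *v x) = 1" "y = S *v x"
  shows "conj_transpose S *v y = x" "S *v y = y + conj_transpose S *v x - x" "cinner x y = 1 / 2"
proof -
  define A where "A = mat 1 - (mat (1 - \<i>)) ** S"
  define B where "B = mat 1 - (mat (1 + \<i>)) ** S"
  have Av: "A *v z = z - (1 - \<i>) *s (S *v z)" and Bv: "B *v z = z - (1 + \<i>) *s (S *v z)" for z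
    by (simp_all add: A_def B_def matrix_vector_mult_diff_rdistrib scalar_mat_vector flip: matrix_vector_mul_assoc)
  have cA: "conj_transpose A *v z = z - (1 + \<i>) *s (conj_transpose S *v z)"
   and cB: "conj_transpose B *v z = z - (1 - \<i>) *s (conj_transpose S *v z)" for z
    by (simp_all add: A_def B_def conj_transpose_diff conj_transpose_mult conj_transpose_mat
        matrix_vector_mult_diff_rdistrib scalar_mat_vector vector_scalar_commute matrix_vector_right_distrib
        matrix_vector_mult_diff_distrib flip: matrix_vector_mul_assoc)
  have psdA: "0 \<le> Re (cinner (A *v z) z)" and psdB: "0 \<le> Re (cinner (B *v z) z)" for z
  proof -
    have "cmod (c * cinner (S *v z) z) \<le> (norm z)\<^sup>2" if "cmod c = sqrt 2" for c
      using rad[of z] that by (simp add: norm_mult field_simps)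
    moreover have "cmod (1 - \<i>) = sqrt 2" "cmod (1 + \<i>) = sqrt 2" by (simp_all add: cmod_def)
    ultimately have "Re ((1 - \<i>) * cinner (S *v z) z) \<le> (norm z)\<^sup>2" "Re ((1 + \<i>) * cinner (S *v z) z) \<le> (norm z)\<^sup>2"
      using complex_Re_le_cmod order_trans by blast+
    then show "0 \<le> Re (cinner (A *v z) z)" "0 \<le> Re (cinner (B *v z) z)"
      by (simp_all add: Av Bv cinner_simps cinner_self)
  qed
  define v where "v = y + \<i> *s x"
  define w where "w = y - \<i> *s x"
  have xx: "cinner x x = 1" and yy: "cinner y y = 1" using x y by (simp_all add: cinner_self)
  have Sx: "S *v x = y" using y by simp
  have lin: "S *v (a + b) = S *v a + S *v b" "S *v (a - b) = S *v a - S *v b" "S *v (c *s a) = c *s (S *v a)" for a b c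
    by (simp_all add: matrix_vector_right_distrib matrix_vector_mult_diff_distrib vector_scalar_commute)
  have lin': "conj_transpose S *v (a + b) = conj_transpose S *v a + conj_transpose S *v b"
    "conj_transpose S *v (a - b) = conj_transpose S *v a - conj_transpose S *v b"
    "conj_transpose S *v (c *s a) = c *s (conj_transpose S *v a)" for a b c
    by (simp_all add: matrix_vector_right_distrib matrix_vector_mult_diff_distrib vector_scalar_commute)
  have sos: "2 * Re (cinner (S *v (x - y)) (x - y)) + Re (cinner (A *v v) v) + Re (cinner (B *v w) w) = 0"
    by (simp add: Av Bv v_def w_def lin cinner_simps Sx xx yy cinner_commute[of x y])
  have z0: "Re (cinner (S *v (x - y)) (x - y)) = 0" and zA: "Re (cinner (A *v v) v) = 0" and zB: "Re (cinner (B *v w) w) = 0"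
    using sos pos[of "x - y"] psdA[of v] psdB[of w] by linarith+
  note E0 = psd_form_zero[OF pos z0]
   and EA = psd_form_zero[OF psdA zA]
   and EB = psd_form_zero[OF psdB zB]
  let ?Sy = "S *v y" and ?Tx = "conj_transpose S *v x" and ?Ty = "conj_transpose S *v y"
  \<comment> \<open>The kernel equations are linear in the five vectors below, so they can be solved coordinatewise.\<close>
  have *: "?Ty $ i = x $ i \<and> ?Sy $ i = y $ i + ?Tx $ i - x $ i" for i
  proof -
    define X where "X = x $ i"
    define Y where "Y = y $ i"
    define P where "P = ?Sy $ i"
    define Q where "Q = ?Tx $ i"
    define R where "R = ?Ty $ i"
    have 0: "Y - P + (Q - R) = 0"
      using arg_cong[OF E0, of "\<lambda>a. a $ i"] by (simp add: lin lin' Sx X_def Y_def P_def Q_def R_def algebra_simps)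
    have 1: "(Y + \<i> * X) - (1 - \<i>) * (P + \<i> * Y) + ((Y + \<i> * X) - (1 + \<i>) * (R + \<i> * Q)) = 0"
      using arg_cong[OF EA, of "\<lambda>a. a $ i"] by (simp add: Av cA v_def lin lin' Sx X_def Y_def P_def Q_def R_def algebra_simps)
    have 2: "(Y - \<i> * X) - (1 + \<i>) * (P - \<i> * Y) + ((Y - \<i> * X) - (1 - \<i>) * (R - \<i> * Q)) = 0"
      using arg_cong[OF EB, of "\<lambda>a. a $ i"] by (simp add: Bv cB w_def lin lin' Sx X_def Y_def P_def Q_def R_def algebra_simps)
    have "R = X" using 0 1 2 by (simp add: complex_eq_iff)
    moreover have "P = Y + Q - X" using 0 \<open>R = X\<close> by (simp add: algebra_simps)
    ultimately show ?thesis by (simp add: X_def Y_def P_def Q_def R_def)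
  qed
  show Ty: "conj_transpose S *v y = x" and Sy: "S *v y = y + conj_transpose S *v x - x"
    using * by (simp_all add: vec_eq_iff)
  \<comment> \<open>It remains to evaluate the form of \<open>S\<close> at \<open>v\<close> and \<open>w\<close> in terms of \<open>s\<close>.\<close>
  define s where "s = cinner x y"
  have sc: "cinner y x = cnj s" unfolding s_def by (rule cinner_commute)
  have Syy: "cinner (S *v y) y = cnj s" by (simp add: cinner_matrix_vector Ty sc)
  have Txx: "cinner (conj_transpose S *v x) x = s"
    unfolding cinner_matrix_vector by (simp add: Sx s_def)
  have Syx: "cinner (S *v y) x = s + cnj s - 1"
    unfolding Sy by (simp add: cinner_simps sc Txx xx)
  have Re_v: "Re (cinner (S *v v) v) = 2 * Re s" and norm_v: "(norm v)\<^sup>2 = 2 - 2 * Im s"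
  proof -
    show "Re (cinner (S *v v) v) = 2 * Re s"
      by (simp add: v_def lin cinner_simps Sx Syy Syx yy sc)
    have "complex_of_real ((norm v)\<^sup>2) = of_real (2 - 2 * Im s)"
      unfolding cinner_self[symmetric]
      by (simp add: v_def cinner_simps xx yy sc s_def[symmetric] complex_eq_iff)
    then show "(norm v)\<^sup>2 = 2 - 2 * Im s" by (simp only: of_real_eq_iff)
  qed
  have Re_w: "Re (cinner (S *v w) w) = 2 * Re s" and norm_w: "(norm w)\<^sup>2 = 2 + 2 * Im s"
  proof -
    show "Re (cinner (S *v w) w) = 2 * Re s"
      by (simp add: w_def lin cinner_simps Sx Syy Syx yy sc)
    have "complex_of_real ((norm w)\<^sup>2) = of_real (2 + 2 * Im s)"
      unfolding cinner_self[symmetric]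
      by (simp add: w_def cinner_simps xx yy sc s_def[symmetric] complex_eq_iff)
    then show "(norm w)\<^sup>2 = 2 + 2 * Im s" by (simp only: of_real_eq_iff)
  qed
  have "Re (cinner (S *v v) v) + Im (cinner (S *v v) v) = (norm v)\<^sup>2"
    using zA by (simp add: Av cinner_simps cinner_self)
  then have "Re (cinner (S *v v) v) = (norm v)\<^sup>2 / 2"
    using rad by (rule tangent_point_of_disc)
  moreover have "Re (cnj (cinner (S *v w) w)) + Im (cnj (cinner (S *v w) w)) = (norm w)\<^sup>2"
    using zB by (simp add: Bv cinner_simps cinner_self)
  then have "Re (cnj (cinner (S *v w) w)) = (norm w)\<^sup>2 / 2"
    by (rule tangent_point_of_disc) (simp add: rad)
  ultimately have "2 * Re s = 1 - Im s" "2 * Re s = 1 + Im s"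
    unfolding Re_v norm_v complex_cnj Re_w norm_w by (simp_all add: Re_w)
  then show "cinner x y = 1 / 2" by (simp add: complex_eq_iff flip: s_def)
qed

text \<open>Complex orthogonality to \<open>u\<close> and \<open>v\<close> is real orthogonality to \<open>u\<close>, \<open>\<i> u\<close>, \<open>v\<close> and \<open>\<i> v\<close>, and four
  vectors do not span a space of real dimension six.\<close>

lemma exists_orthogonal_unit_vector:
  fixes u v :: "complex ^ 3"
  obtains z where "norm z = 1" "cinner z u = 0" "cinner z v = 0"
proof -
  have "dim {u, \<i> *s u, v, \<i> *s v} \<le> card {u, \<i> *s u, v, \<i> *s v}"
    by (rule dim_le_card) (auto intro: span_base)
  also have "\<dots> \<le> 4" by (simp add: card_insert_if)
  also have "4 < DIM(complex ^ 3)" by simp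
  finally obtain z where z: "z \<noteq> 0"
    and orth: "\<And>y. y \<in> span {u, \<i> *s u, v, \<i> *s v} \<Longrightarrow> orthogonal z y"
    by (rule orthogonal_to_subspace_exists) blast
  have Re0: "Re (cinner z y) = 0" if "y \<in> {u, \<i> *s u, v, \<i> *s v}" for y
    using orth[OF span_base[OF that]] by (simp add: Re_cinner orthogonal_def)
  have "cinner z u = 0" "cinner z v = 0"
    using Re0[of u] Re0[of v] Re0[of "\<i> *s u"] Re0[of "\<i> *s v"]
    by (simp_all add: cinner_simps complex_eq_iff)
  then show ?thesis
    using z by (intro that[of "(1 / norm z) *\<^sub>R z"]) (simp_all add: cinner_scaleR)
qed

lemma unitarily_similar_orthonormal_basis:
  fixes e :: "'n::finite \<Rightarrow> complex ^ 'n"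
  assumes "\<And>i j. cinner (e i) (e j) = (if i = j then 1 else 0)"
  shows "unitarily_similar S (\<chi> i j. cinner (S *v e j) (e i))"
proof -
  define U :: "complex ^ 'n ^ 'n" where "U = (\<chi> i j. e j $ i)"
  have UU: "conj_transpose U ** U = mat 1"
    using assms by (simp add: vec_eq_iff matrix_matrix_mult_def conj_transpose_def U_def mat_def
        cinner_def mult.commute)
  then have UU': "U ** conj_transpose U = mat 1"
    by (simp add: matrix_left_right_inverse)
  have SU: "(S ** U) $ k $ j = (S *v e j) $ k" for k j
    by (simp add: matrix_matrix_mult_def matrix_vector_mult_def U_def)
  have "(\<chi> i j. cinner (S *v e j) (e i)) = conj_transpose U ** (S ** U)"
    unfolding vec_eq_iff matrix_matrix_mult_def[of "conj_transpose U"]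
    by (simp add: SU cinner_def) (simp add: conj_transpose_def U_def mult.commute)
  then have "U ** (\<chi> i j. cinner (S *v e j) (e i)) ** conj_transpose U
      = (U ** conj_transpose U) ** S ** (U ** conj_transpose U)"
    by (simp only: matrix_mul_assoc)
  then have "S = U ** (\<chi> i j. cinner (S *v e j) (e i)) ** conj_transpose U"
    by (simp add: UU')
  then show ?thesis
    using UU UU' unfolding unitarily_similar_def unitary_matrix_def by blast
qed

text \<open>Since \<open>\<langle>x, y\<rangle> = 1 / 2\<close>, the vectors \<open>x + y\<close> and \<open>x - y\<close> are orthogonal, of norms \<open>sqrt 3\<close> and 1.
  After normalization and completion by a third vector \<open>e3\<close> they form an orthonormal basis, in which
  every entry of the matrix except the last one is determined by \<open>norming_pair\<close> and by
  \<open>\<langle>k, e3\<rangle>\<close>, where \<open>k = S x + S\<^sup>* x\<close>. The free phase of \<open>e3\<close> makes the latter number nonnegative.\<close>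

lemma unitarily_similar_canonical:
  fixes S :: "complex ^ 3 ^ 3"
  assumes pos: "\<And>z. 0 \<le> Re (cinner (S *v z) z)"
    and rad: "\<And>z. cmod (cinner (S *v z) z) \<le> (norm z)\<^sup>2 / sqrt 2"
    and x: "norm x = 1" and Sx: "norm (S *v x) = 1"
  obtains d b1 b2 where "d \<ge> 0" "unitarily_similar S (canonical_matrix d b1 b2)"
proof -
  define y where "y = S *v x"
  note pair = norming_pair[OF pos rad x Sx y_def]
  define k where "k = y + conj_transpose S *v x"
  have xx: "cinner x x = 1" and yy: "cinner y y = 1" using x Sx by (simp_all add: cinner_self y_def)
  have xy: "cinner x y = 1 / 2" by (rule pair)
  have yx: "cinner y x = 1 / 2" using cinner_commute[of y x] xy by simp
  have Sy: "S *v y = k - x" using pair(2) by (simp add: k_def)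
  have Tx: "conj_transpose S *v x = k - y" by (simp add: k_def)
  have Ty: "conj_transpose S *v y = x" by (rule pair)
  have kx: "cinner k x = 1"
    by (simp add: k_def cinner_simps yx cinner_matrix_vector[of "conj_transpose S"] y_def[symmetric] xy)
  have ky: "cinner k y = 1"
    by (simp add: k_def cinner_simps yy cinner_matrix_vector[of "conj_transpose S"] Sy xx xy)
      (simp add: k_def cinner_simps xx xy yx cinner_commute[of x] cinner_matrix_vector y_def[symmetric])
  define e1 where "e1 = of_real (1 / sqrt 3) *s (x + y)"
  define e2 where "e2 = x - y"
  obtain z where z: "norm z = 1" "cinner z x = 0" "cinner z y = 0"
    by (rule exists_orthogonal_unit_vector)
  \<comment> \<open>The phase that makes the inner product of \<open>k\<close> with \<open>e3\<close> a nonnegative real.\<close>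
  define c where "c = (if cinner k z = 0 then 1 else sgn (cinner k z))"
  have "cmod c = 1" by (simp add: c_def norm_sgn)
  define e3 where "e3 = c *s z"
  have cc: "c * cnj c = 1" using \<open>cmod c = 1\<close> by (simp flip: complex_norm_square)
  have "cinner z z = 1" using z(1) by (simp add: cinner_self)
  then have e3e3: "cinner e3 e3 = 1"
    using cc by (simp add: e3_def cinner_smult_left cinner_smult_right mult.commute)
  have e3x: "cinner e3 x = 0" and e3y: "cinner e3 y = 0" using z by (simp_all add: e3_def cinner_simps)
  have xe3: "cinner x e3 = 0" and ye3: "cinner y e3 = 0"
    using cinner_commute[of x e3] cinner_commute[of y e3] e3x e3y by simp_all
  have ke3: "cinner k e3 = of_real (cmod (cinner k z))"
    by (simp add: e3_def cinner_simps c_def sgn_eq mult.commute flip: complex_norm_square)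
       (simp add: power2_eq_square)
  define d where "d = cmod (cinner k z) / sqrt 3"
  have "d \<ge> 0" by (simp add: d_def)
  have ke3': "cinner k e3 = of_real (sqrt 3 * d)" by (simp add: ke3 d_def)
  have e3k: "cinner e3 k = of_real (sqrt 3 * d)" using cinner_commute[of e3 k] ke3' by simp
  define b where "b = cinner (S *v e3) e3"
  have r3: "complex_of_real (sqrt 3) * complex_of_real (sqrt 3) = 3"
    by (simp flip: of_real_mult)
  have Se1: "S *v e1 = of_real (1 / sqrt 3) *s (y + k - x)"
    by (simp add: e1_def vector_scalar_commute matrix_vector_right_distrib y_def[symmetric] Sy)
  have Se2: "S *v e2 = y - k + x"
    by (simp add: e2_def matrix_vector_mult_diff_distrib y_def[symmetric] Sy)
  have Te1: "conj_transpose S *v e1 = of_real (1 / sqrt 3) *s (k - y + x)"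
    by (simp add: e1_def vector_scalar_commute matrix_vector_right_distrib Tx Ty)
  have Te2: "conj_transpose S *v e2 = k - y - x"
    by (simp add: e2_def matrix_vector_mult_diff_distrib Tx Ty)
  define e :: "3 \<Rightarrow> complex ^ 3" where "e = ($) (vector [e1, e2, e3])"
  have e: "e 1 = e1" "e 2 = e2" "e 3 = e3" by (simp_all add: e_def)
  have "cinner (e i) (e j) = (if i = j then 1 else 0)" for i j
  proof -
    have "\<forall>i j. cinner (e i) (e j) = (if i = j then 1 else 0)"
      unfolding forall_3 e
      by (simp add: e1_def e2_def cinner_simps xx yy xy yx e3x e3y xe3 ye3 e3e3 r3)
    then show ?thesis by blast
  qed
  then have "unitarily_similar S (\<chi> i j. cinner (S *v e j) (e i))"
    by (rule unitarily_similar_orthonormal_basis)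
  also have "(\<chi> i j. cinner (S *v e j) (e i)) = canonical_matrix d (Re b) (Im b)"
  proof -
    have 1: "cinner (S *v e1) e1 = 2 / 3" "cinner (S *v e2) e1 = of_real (1 / sqrt 3)"
      "cinner (S *v e1) e2 = - of_real (1 / sqrt 3)" "cinner (S *v e2) e2 = 0"
      unfolding Se1 Se2 by (simp_all add: e1_def e2_def cinner_simps xx yy xy yx kx ky r3)
    have 2: "cinner (S *v e1) e3 = of_real d" "cinner (S *v e2) e3 = - of_real (sqrt 3 * d)"
      unfolding Se1 Se2 by (simp_all add: cinner_simps xe3 ye3 ke3')
    have 3: "cinner (S *v e3) e1 = of_real d" "cinner (S *v e3) e2 = of_real (sqrt 3 * d)"
      unfolding cinner_matrix_vector Te1 Te2 by (simp_all add: cinner_simps e3x e3y e3k)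
    show ?thesis
      by (simp add: vec_eq_iff forall_3 e 1 2 3 canonical_matrix_def) (simp add: b_def complex_eq_iff)
  qed
  finally show ?thesis using that \<open>d \<ge> 0\<close> by blast
qed

section \<open>Reducing eigenvectors and irreducibility\<close>

text \<open>A vector that spans a one-dimensional reducing subspace: the adjoint has it as an
  eigenvector, too, and then necessarily for the conjugate eigenvalue.\<close>

definition reducing_eigenvector :: "complex ^ 'n ^ 'n \<Rightarrow> complex \<Rightarrow> complex ^ 'n \<Rightarrow> bool" where
  "reducing_eigenvector A \<mu> z \<longleftrightarrow> z \<noteq> 0 \<and> A *v z = \<mu> *s z \<and> conj_transpose A *v z = cnj \<mu> *s z"

lemma reducing_eigenvector_unitarily_similar:
  assumes "unitarily_similar A B" "reducing_eigenvector B \<mu> z"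
  shows "\<exists>w. reducing_eigenvector A \<mu> w"
proof -
  obtain U where U: "unitary_matrix U" "A = U ** B ** conj_transpose U"
    using assms by (auto simp: unitarily_similar_def)
  have z: "z \<noteq> 0" "B *v z = \<mu> *s z" "conj_transpose B *v z = cnj \<mu> *s z"
    using assms by (auto simp: reducing_eigenvector_def)
  have UUz: "conj_transpose U *v (U *v z) = z"
    using U(1) by (simp add: matrix_vector_mul_assoc unitary_matrix_def)
  have "U *v z \<noteq> 0" using unitary_norm[OF U(1), of z] z(1) by auto
  moreover have "A *v (U *v z) = \<mu> *s (U *v z)"
    unfolding U(2) by (simp add: UUz z(2) vector_scalar_commute flip: matrix_vector_mul_assoc)
  moreover have "conj_transpose A *v (U *v z) = cnj \<mu> *s (U *v z)"
    unfolding U(2) conj_transpose_mult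
    by (simp add: UUz z(3) vector_scalar_commute flip: matrix_vector_mul_assoc)
  ultimately show ?thesis unfolding reducing_eigenvector_def by blast
qed

lemma reducing_eigenvector_scaleR:
  assumes "reducing_eigenvector A \<mu> z" shows "reducing_eigenvector (r *\<^sub>R A) (of_real r * \<mu>) z"
  using assms by (simp add: reducing_eigenvector_def scaleR_matrix_vector conj_transpose_scaleR scaleR_eq_smult)

lemma conj_transpose_direct_sum:
  "conj_transpose (direct_sum A B) = direct_sum (conj_transpose A) (conj_transpose B)"
  by (simp add: conj_transpose_def direct_sum_def vec_eq_iff split: sum.split)

lemma matrix_vector_axis: "(A *v axis k 1) $ i = A $ i $ k" for A :: "complex ^ 'n ^ 'm"
  by (simp add: matrix_vector_mult_def axis_def if_distrib[where f = "\<lambda>x. _ * x"] cong: if_cong)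

lemma direct_sum_axis:
  fixes A :: "complex ^ 1 ^ 1"
  shows "direct_sum A B *v axis (Inl 1) 1 = A $ 1 $ 1 *s axis (Inl 1) 1"
    and "direct_sum B A *v axis (Inr 1) 1 = A $ 1 $ 1 *s axis (Inr 1) 1"
  unfolding vec_eq_iff matrix_vector_axis by (auto simp: direct_sum_def axis_def split: sum.split)

lemma reducing_eigenvector_direct_sum:
  fixes A :: "complex ^ 1 ^ 1"
  shows "\<exists>\<mu> z. reducing_eigenvector (direct_sum A B) \<mu> z" "\<exists>\<mu> z. reducing_eigenvector (direct_sum B A) \<mu> z"
proof -
  have "reducing_eigenvector (direct_sum A B) (A $ 1 $ 1) (axis (Inl 1) 1)"
    by (auto simp: reducing_eigenvector_def conj_transpose_direct_sum direct_sum_axis)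
      (simp add: conj_transpose_def)
  moreover have "reducing_eigenvector (direct_sum B A) (A $ 1 $ 1) (axis (Inr 1) 1)"
    by (auto simp: reducing_eigenvector_def conj_transpose_direct_sum direct_sum_axis)
      (simp add: conj_transpose_def)
  ultimately show "\<exists>\<mu> z. reducing_eigenvector (direct_sum A B) \<mu> z" "\<exists>\<mu> z. reducing_eigenvector (direct_sum B A) \<mu> z"
    by blast+
qed

text \<open>A direct sum decomposition in dimension 3 has a summand of size 1.\<close>

lemma not_unitarily_irreducible_reducing_eigenvector:
  assumes "\<not> unitarily_irreducible T" shows "\<exists>\<mu> z. reducing_eigenvector T \<mu> z"
  using assms unfolding unitarily_irreducible_def
  by (meson reducing_eigenvector_direct_sum reducing_eigenvector_unitarily_similar)

lemma canonical_adjoint_mult_components: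
  "(conj_transpose (canonical_matrix d b1 b2) *v z) $ 1 =
     2 / 3 * z $ 1 - of_real (1 / sqrt 3) * z $ 2 + of_real d * z $ 3"
  "(conj_transpose (canonical_matrix d b1 b2) *v z) $ 2 =
     of_real (1 / sqrt 3) * z $ 1 - of_real (sqrt 3 * d) * z $ 3"
  "(conj_transpose (canonical_matrix d b1 b2) *v z) $ 3 =
     of_real d * z $ 1 + of_real (sqrt 3 * d) * z $ 2 + cnj (Complex b1 b2) * z $ 3"
  by (simp_all add: canonical_matrix_def conj_transpose_def matrix_vector_mult_def sum_3 complex_eq_iff)

text \<open>Each coordinate of the two eigenvector equations has this shape, with \<open>u\<close> coming from the Hermitian
  and \<open>v\<close> from the skew part of the matrix.\<close>

lemma hermitian_and_skew_parts:
  fixes u v x :: complex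
  assumes "u + v = (of_real a + \<i> * of_real b) * x" "u - v = (of_real a - \<i> * of_real b) * x"
  shows "u = of_real a * x" "v = \<i> * of_real b * x"
proof -
  have "2 * u = (u + v) + (u - v)" "2 * v = (u + v) - (u - v)" by simp_all
  then have "2 * u = 2 * (of_real a * x)" "2 * v = 2 * (\<i> * of_real b * x)"
    unfolding assms by (simp_all add: algebra_simps)
  then show "u = of_real a * x" "v = \<i> * of_real b * x" by simp_all
qed

text \<open>A reducing eigenvector is an eigenvector of both the Hermitian part \<open>H\<close> and the skew part \<open>\<i> K\<close>, with
  eigenvalues \<open>a\<close> and \<open>\<i> b\<close>. As \<open>H\<close> annihilates the second basis vector, \<open>a z\<^sub>2 = 0\<close>. If \<open>z\<^sub>2 = 0\<close>, the
  equations force \<open>b1 = 1 - 3 d\<^sup>2\<close> and \<open>b2 = 0\<close>; if \<open>a = 0\<close>, they force \<open>b1 = 3 d\<^sup>2 / 2\<close> and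
  \<open>b2 = \<plusminus> (1 - 9 d\<^sup>2 / 2)\<close>. In both cases the last entry is too large for the bound in
  \<open>admissible\<close>.\<close>

lemma canonical_no_reducing_eigenvector:
  assumes adm: "admissible d b1 b2" and d: "d > 0"
  shows "\<not> reducing_eigenvector (canonical_matrix d b1 b2) \<mu> z"
proof
  assume "reducing_eigenvector (canonical_matrix d b1 b2) \<mu> z"
  then have "z \<noteq> 0" and ev: "canonical_matrix d b1 b2 *v z = \<mu> *s z"
    "conj_transpose (canonical_matrix d b1 b2) *v z = cnj \<mu> *s z"
    by (auto simp: reducing_eigenvector_def)
  define r where "r = complex_of_real (sqrt 3)"
  have r: "r * r = 3" by (simp add: r_def flip: of_real_mult)
  have inverse_r: "complex_of_real (1 / sqrt 3) = r / 3"
    unfolding inverse_sqrt_3 by (simp add: r_def)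
  obtain a b where \<mu>: "\<mu> = Complex a b" by (cases \<mu>)
  define x1 where "x1 = z $ 1"
  define x2 where "x2 = z $ 2"
  define x3 where "x3 = z $ 3"
  let ?d = "complex_of_real d"
  have nz: "x1 \<noteq> 0 \<or> x2 \<noteq> 0 \<or> x3 \<noteq> 0"
    using \<open>z \<noteq> 0\<close> by (auto simp: vec_eq_iff forall_3 x1_def x2_def x3_def)
  have e1: "(2 / 3 * x1 + ?d * x3) + r / 3 * x2 = (of_real a + \<i> * of_real b) * x1"
    and e2: "0 + (r * ?d * x3 - r / 3 * x1) = (of_real a + \<i> * of_real b) * x2"
    and e3: "(?d * x1 + of_real b1 * x3) + (\<i> * of_real b2 * x3 - r * ?d * x2)
      = (of_real a + \<i> * of_real b) * x3"
    using ev(1) unfolding vec_eq_iff forall_3 canonical_mult_components inverse_r \<mu>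
    by (simp_all add: x1_def x2_def x3_def r_def Complex_eq algebra_simps)
  have f1: "(2 / 3 * x1 + ?d * x3) - r / 3 * x2 = (of_real a - \<i> * of_real b) * x1"
    and f2: "0 - (r * ?d * x3 - r / 3 * x1) = (of_real a - \<i> * of_real b) * x2"
    and f3: "(?d * x1 + of_real b1 * x3) - (\<i> * of_real b2 * x3 - r * ?d * x2)
      = (of_real a - \<i> * of_real b) * x3"
    using ev(2) unfolding vec_eq_iff forall_3 canonical_adjoint_mult_components inverse_r \<mu>
    by (simp_all add: x1_def x2_def x3_def r_def Complex_eq algebra_simps)
  note h1 = hermitian_and_skew_parts(1)[OF e1 f1] and k1 = hermitian_and_skew_parts(2)[OF e1 f1]
  note h2 = hermitian_and_skew_parts(1)[OF e2 f2] and k2 = hermitian_and_skew_parts(2)[OF e2 f2]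
  note h3 = hermitian_and_skew_parts(1)[OF e3 f3] and k3 = hermitian_and_skew_parts(2)[OF e3 f3]
  have r0: "r \<noteq> 0" using r by auto
  have d0: "?d \<noteq> 0" using d by simp
  have le: "sqrt (2 * (12 * d\<^sup>2 + b1)\<^sup>2 + 2 * b2\<^sup>2) \<le> 1 - 18 * d\<^sup>2"
    using adm by (simp add: admissible_def)
  then have "0 \<le> 1 - 18 * d\<^sup>2" by (rule order_trans[rotated]) simp
  with le have sq: "2 * (12 * d\<^sup>2 + b1)\<^sup>2 + 2 * b2\<^sup>2 \<le> (1 - 18 * d\<^sup>2)\<^sup>2"
    by (simp add: sqrt_le_D)
  show False
  proof (cases "x2 = 0")
    case True
    have x1: "x1 = 3 * ?d * x3" using k2 r0 True by (simp add: field_simps)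
    then have x3: "x3 \<noteq> 0" using nz True by auto
    have "b = 0" using k1 True x1 x3 d0 by simp
    then have b2: "b2 = 0" using k3 True x3 by simp
    have "of_real a * (3 * ?d * x3) = 3 * ?d * x3" using h1 unfolding x1 by (simp add: algebra_simps)
    then have a: "a = 1" using x3 d0 by simp
    have "(3 * ?d * ?d + of_real b1) * x3 = 1 * x3" using h3 a unfolding x1 by (simp add: algebra_simps)
    then have "of_real (3 * d * d + b1) = complex_of_real 1" using x3 by simp
    then have "b1 = 1 - 3 * d\<^sup>2" unfolding of_real_eq_iff by (simp add: power2_eq_square)
    then have sum: "12 * d\<^sup>2 + b1 = 1 + 9 * d\<^sup>2" by simp
    have "2 * (1 + 9 * d\<^sup>2)\<^sup>2 \<le> (1 - 18 * d\<^sup>2)\<^sup>2" using sq b2 unfolding sum by simp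
    moreover have "(1 - 18 * d\<^sup>2)\<^sup>2 \<le> 1" using \<open>0 \<le> 1 - 18 * d\<^sup>2\<close> by (intro power_le_one) auto
    moreover have "1 \<le> (1 + 9 * d\<^sup>2)\<^sup>2" by (intro one_le_power) simp
    ultimately show False by linarith
  next
    case False
    then have a: "a = 0" using h2 by simp
    have "x1 = 3 / 2 * (2 / 3 * x1 + ?d * x3) - 3 / 2 * ?d * x3" by (simp add: algebra_simps)
    then have x1: "x1 = - 3 / 2 * ?d * x3" unfolding h1 a by simp
    then have x3: "x3 \<noteq> 0" using k1 r0 False by auto
    have "of_real (b1 - 3 / 2 * d * d) * x3 = 0" using h3 a x1 by (simp add: algebra_simps)
    then have b1: "b1 = 3 / 2 * d\<^sup>2" using x3 unfolding mult_eq_0_iff of_real_eq_0_iff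
      by (simp add: power2_eq_square)
    have "of_real (b * b) * x1 = 1 * x1"
    proof -
      have "r / 3 * (r * ?d * x3 - r / 3 * x1) = r * r * (?d * x3 / 3 - x1 / 9)"
        by (simp add: algebra_simps)
      also have "\<dots> = - x1" unfolding r x1 by (simp add: algebra_simps)
      finally have "- x1 = r / 3 * (\<i> * of_real b * x2)" using k2 by simp
      also have "\<dots> = \<i> * of_real b * (r / 3 * x2)" by simp
      also have "\<dots> = - (of_real (b * b) * x1)" unfolding k1 by (simp add: mult_ac flip: mult.assoc[of \<i> \<i>])
      finally show ?thesis by simp
    qed
    then have bb: "b * b = 1" using x1 x3 d0 by (simp flip: of_real_mult)
    have "\<i> * (of_real b2 * x3) = r * ?d * x2 + \<i> * of_real b * x3"
      using k3 by (simp add: algebra_simps)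
    also have "r * ?d * x2 = 3 * ?d * (r / 3 * x2)" by simp
    also have "\<dots> + \<i> * of_real b * x3 = \<i> * (of_real (b * (1 - 9 / 2 * d * d)) * x3)"
      unfolding k1 x1 by (simp add: algebra_simps)
    finally have "of_real b2 * x3 = of_real (b * (1 - 9 / 2 * d * d)) * x3"
      by simp
    then have "b2 = b * (1 - 9 / 2 * d * d)" using x3 unfolding mult_cancel_right of_real_eq_iff by simp
    then have "b2\<^sup>2 = (1 - 9 / 2 * d\<^sup>2)\<^sup>2"
      using bb by (simp add: power2_eq_square mult_ac)
    then have "2 * (27 / 2 * d\<^sup>2)\<^sup>2 + 2 * (1 - 9 / 2 * d\<^sup>2)\<^sup>2 \<le> (1 - 18 * d\<^sup>2)\<^sup>2" using sq b1 by simp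
    then have "1 + 18 * d\<^sup>2 + 81 * (d\<^sup>2)\<^sup>2 \<le> 0" by (simp add: power2_eq_square algebra_simps)
    moreover have "0 \<le> d\<^sup>2" "0 \<le> (d\<^sup>2)\<^sup>2" by simp_all
    ultimately show False by linarith
  qed
qed

section \<open>The characterization\<close>

theorem theorem3p6:
  fixes T :: "complex ^ 3 ^ 3"
  assumes "T \<noteq> 0"
  shows "((numerical_range T \<subseteq> right_half_plane \<and> op_norm T / numerical_radius T = sqrt 2) \<longleftrightarrow>
          (\<exists>d b1 b2. admissible d b1 b2 \<and>
             unitarily_similar (T /\<^sub>R op_norm T) (canonical_matrix d b1 b2))) \<and>
         ((\<exists>d b1 b2. d > 0 \<and> admissible d b1 b2 \<and>
             unitarily_similar (T /\<^sub>R op_norm T) (canonical_matrix d b1 b2)) \<longrightarrow>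
          unitarily_irreducible T)"
proof -
  define t where "t = op_norm T"
  have t: "t > 0" unfolding t_def by (rule op_norm_pos[OF assms])
  define S where "S = T /\<^sub>R t"
  have T: "T = t *\<^sub>R S" using t by (simp add: S_def)
  have form: "cinner (T *v z) z = of_real t * cinner (S *v z) z" for z
    unfolding T by (simp add: scaleR_matrix_vector cinner_scaleR)
  have half_plane: "numerical_range T \<subseteq> right_half_plane \<longleftrightarrow> (\<forall>z. 0 \<le> Re (cinner (S *v z) z))"
    unfolding numerical_range_right_half_plane_iff form using t by (simp add: zero_le_mult_iff)
  have canonical_iff: "admissible d b1 b2 \<longleftrightarrow> d \<ge> 0 \<and> (\<forall>z. 0 \<le> Re (cinner (S *v z) z)) \<and>
      (\<forall>z. cmod (cinner (S *v z) z) \<le> (norm z)\<^sup>2 / sqrt 2)"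
    if "unitarily_similar S (canonical_matrix d b1 b2)" for d b1 b2
  proof -
    note W = numerical_range_unitarily_similar[OF that]
    have "(\<forall>z. 0 \<le> Re (cinner (S *v z) z)) \<longleftrightarrow> 3 * d\<^sup>2 / 2 \<le> b1"
      unfolding canonical_Re_nonneg_iff[symmetric, of d b1 b2] numerical_range_right_half_plane_iff[symmetric] W ..
    moreover have "(\<forall>z. cmod (cinner (S *v z) z) \<le> (norm z)\<^sup>2 / sqrt 2) \<longleftrightarrow>
        18 * d\<^sup>2 + sqrt (2 * (12 * d\<^sup>2 + b1)\<^sup>2 + 2 * b2\<^sup>2) \<le> 1"
      using numerical_range_bound_iff[of S "1 / sqrt 2"]
        numerical_range_bound_iff[of "canonical_matrix d b1 b2" "1 / sqrt 2"]
      unfolding canonical_numerical_bound_iff[symmetric] by (simp add: W)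
    ultimately show ?thesis unfolding admissible_def by simp
  qed
  have ab: "\<exists>d b1 b2. admissible d b1 b2 \<and> unitarily_similar S (canonical_matrix d b1 b2)"
    if W: "numerical_range T \<subseteq> right_half_plane" and ratio: "t / numerical_radius T = sqrt 2"
  proof -
    have "numerical_radius T \<noteq> 0" using ratio by auto
    then have radius: "numerical_radius T = t / sqrt 2" using ratio by (simp add: field_simps)
    have pos: "0 \<le> Re (cinner (S *v z) z)" for z using W half_plane by blast
    have rad: "cmod (cinner (S *v z) z) \<le> (norm z)\<^sup>2 / sqrt 2" for z
    proof -
      have "t * cmod (cinner (S *v z) z) \<le> t * ((norm z)\<^sup>2 / sqrt 2)"
        using cinner_le_numerical_radius[of T z] t unfolding form radius by (simp add: norm_mult)
      then show ?thesis using t by (simp only: mult_le_cancel_left_pos)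
    qed
    obtain x where x: "norm x = 1" "norm (T *v x) = t"
      unfolding t_def by (rule op_norm_attained)
    have "norm (S *v x) = 1"
      using x(2) t unfolding S_def scaleR_matrix_vector by simp
    then obtain d b1 b2 where "d \<ge> 0" "unitarily_similar S (canonical_matrix d b1 b2)"
      using unitarily_similar_canonical[OF pos rad x(1)] by blast
    then show ?thesis using canonical_iff pos rad by blast
  qed
  have ba: "numerical_range T \<subseteq> right_half_plane \<and> t / numerical_radius T = sqrt 2"
    if adm: "admissible d b1 b2" and sim: "unitarily_similar S (canonical_matrix d b1 b2)" for d b1 b2
  proof
    show "numerical_range T \<subseteq> right_half_plane"
      using canonical_iff[OF sim] adm half_plane by blast
    obtain \<mu> where \<mu>: "\<mu> \<in> numerical_range S" "cmod \<mu> = 1 / sqrt 2"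
      using canonical_numerical_radius_attained[of d b1 b2]
      unfolding numerical_range_unitarily_similar[OF sim, symmetric] by blast
    have W: "numerical_range T = (*) (of_real t) ` numerical_range S"
      unfolding T by (rule numerical_range_scaleR)
    have "\<forall>\<nu>\<in>numerical_range S. cmod \<nu> \<le> 1 / sqrt 2"
      using canonical_iff[OF sim] adm unfolding numerical_range_bound_iff by simp
    then have "numerical_radius T = t / sqrt 2"
      unfolding numerical_radius_eq_SUP W
      using \<mu> t by (intro cSup_eq_maximum) (auto simp: norm_mult image_image field_simps intro!: image_eqI[of _ _ \<mu>])
    then show "t / numerical_radius T = sqrt 2" using t by simp
  qed
  have irred: "unitarily_irreducible T"
    if "d > 0" and adm: "admissible d b1 b2" and sim: "unitarily_similar S (canonical_matrix d b1 b2)" for d b1 b2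
  proof (rule ccontr)
    assume "\<not> unitarily_irreducible T"
    then obtain \<mu> z where "reducing_eigenvector T \<mu> z"
      using not_unitarily_irreducible_reducing_eigenvector by blast
    then obtain \<nu> where "reducing_eigenvector S \<nu> z"
      unfolding S_def using reducing_eigenvector_scaleR by blast
    then obtain w where "reducing_eigenvector (canonical_matrix d b1 b2) \<nu> w"
      using reducing_eigenvector_unitarily_similar[OF unitarily_similar_sym[OF sim]] by blast
    then show False
      using canonical_no_reducing_eigenvector[OF adm \<open>d > 0\<close>] by blast
  qed
  show ?thesis
    unfolding t_def[symmetric] S_def[symmetric] using ab ba irred by blast
qed

end
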